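(* Let $H\in\mathbb{R}$, let $U\subset\mathbb{C}$ be an open set containing the closed unit disc $\overline{\mathbb{D}}=\mathbb{D}\cup\partial\mathbb{D}$, and let $f:U\to\mathbb{R}^3$ be a conformal immersion with constant mean curvature $H$ (with respect to a unit normal field $N$), such that the boundary curve $\gamma(t)=f(e^{it})$, $t\in[0,2\pi]$, is a regular real-analytic closed curve $C=f(\partial\mathbb{D})$. Let $\kappa_n$ and $\tau_g$ denote the normal curvature and geodesic torsion of $\gamma$ with respect to $f$. Then: (1) The surface $f(\overline{\mathbb{D}})$ is totally umbilic if and only if at least one of $\kappa_n$, $\tau_g$ is constant along $\gamma$. In this case both are constant, and $\kappa_n\equiv H$ and $\tau_g\equiv 0$. (2) Otherwise, the mean curvature satisfies \[\min_{\partial\mathbb{D}}\kappa_n \;<\; H \;<\; \max_{\partial\mathbb{D}}\kappa_n .\]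
   Context: Conformal means $\langle f_x,f_x\rangle=\langle f_y,f_y\rangle>0$ and $\langle f_x,f_y\rangle=0$ for $z=x+iy$; the mean curvature is $H=\frac{1}{2}\nu^{-2}\langle f_{xx}+f_{yy},N\rangle$ where $\nu^2=\langle f_x,f_x\rangle$. Totally umbilic means every point is an umbilic (the surface is part of a round sphere or a plane). Along the boundary curve, let $s$ be arc length, $X=d\gamma/ds$ the unit tangent, $N$ the surface unit normal restricted to $\gamma$, and $Y=N\times X$ the unit conormal (Darboux frame). The normal curvature is $\kappa_n=\langle dX/ds, N\rangle$ and the geodesic torsion is $\tau_g=\langle dY/ds, N\rangle=-\langle dN/ds, Y\rangle$. *)

theory Defs
  imports "HOL-Analysis.Analysis" "HOL-Analysis.Cross3"
begin

definition pdx :: "(complex \<Rightarrow> 'a::real_normed_vector) \<Rightarrow> complex \<Rightarrow> 'a" where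
  "pdx g z = vector_derivative (\<lambda>t::real. g (z + complex_of_real t)) (at 0)"

definition pdy :: "(complex \<Rightarrow> 'a::real_normed_vector) \<Rightarrow> complex \<Rightarrow> 'a" where
  "pdy g z = vector_derivative (\<lambda>t::real. g (z + \<i> * complex_of_real t)) (at 0)"

definition C2_on :: "complex set \<Rightarrow> (complex \<Rightarrow> real^3) \<Rightarrow> bool" where
  "C2_on U f \<longleftrightarrow>
     (\<forall>z\<in>U. f differentiable (at z) \<and> pdx f differentiable (at z) \<and> pdy f differentiable (at z)) \<and>
     continuous_on U (pdx (pdx f)) \<and> continuous_on U (pdy (pdx f)) \<and>
     continuous_on U (pdx (pdy f)) \<and> continuous_on U (pdy (pdy f))"

definition conformal_on :: "complex set \<Rightarrow> (complex \<Rightarrow> real^3) \<Rightarrow> bool" where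
  "conformal_on U f \<longleftrightarrow> (\<forall>z\<in>U. pdx f z \<bullet> pdx f z = pdy f z \<bullet> pdy f z \<and>
                               pdx f z \<bullet> pdx f z > 0 \<and> pdx f z \<bullet> pdy f z = 0)"

definition unit_normal_field :: "complex set \<Rightarrow> (complex \<Rightarrow> real^3) \<Rightarrow> (complex \<Rightarrow> real^3) \<Rightarrow> bool" where
  "unit_normal_field U f N \<longleftrightarrow> continuous_on U N \<and>
     (\<forall>z\<in>U. norm (N z) = 1 \<and> N z \<bullet> pdx f z = 0 \<and> N z \<bullet> pdy f z = 0)"

definition mean_curv :: "(complex \<Rightarrow> real^3) \<Rightarrow> (complex \<Rightarrow> real^3) \<Rightarrow> complex \<Rightarrow> real" where
  "mean_curv f N z = (1/2) * ((pdx (pdx f) z + pdy (pdy f) z) \<bullet> N z) / (pdx f z \<bullet> pdx f z)"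

text \<open>Umbilic point: second fundamental form proportional to the first.\<close>
definition umbilic_at :: "(complex \<Rightarrow> real^3) \<Rightarrow> (complex \<Rightarrow> real^3) \<Rightarrow> complex \<Rightarrow> bool" where
  "umbilic_at f N z \<longleftrightarrow> (\<exists>k::real.
      pdx (pdx f) z \<bullet> N z = k * (pdx f z \<bullet> pdx f z) \<and>
      pdy (pdx f) z \<bullet> N z = k * (pdx f z \<bullet> pdy f z) \<and>
      pdy (pdy f) z \<bullet> N z = k * (pdy f z \<bullet> pdy f z))"

definition totally_umbilic_on :: "complex set \<Rightarrow> (complex \<Rightarrow> real^3) \<Rightarrow> (complex \<Rightarrow> real^3) \<Rightarrow> bool" where
  "totally_umbilic_on S f N \<longleftrightarrow> (\<forall>z\<in>S. umbilic_at f N z)"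

definition real_analytic_on :: "real set \<Rightarrow> (real \<Rightarrow> real^3) \<Rightarrow> bool" where
  "real_analytic_on S g \<longleftrightarrow> (\<forall>t0\<in>S. \<exists>r>0. \<exists>a::nat \<Rightarrow> real^3.
      \<forall>t. \<bar>t - t0\<bar> < r \<longrightarrow> (\<lambda>n. (t - t0) ^ n *\<^sub>R a n) sums g t)"

text \<open>Boundary curve gamma(t) = f(e^{it}) and its Darboux frame quantities.
  Derivatives in arc length s are d/ds = |gamma'(t)|^-1 d/dt.\<close>
definition bcurve :: "(complex \<Rightarrow> real^3) \<Rightarrow> real \<Rightarrow> real^3" where
  "bcurve f t = f (cis t)"

definition btangent :: "(complex \<Rightarrow> real^3) \<Rightarrow> real \<Rightarrow> real^3" where
  "btangent f t = (1 / norm (vector_derivative (bcurve f) (at t))) *\<^sub>R vector_derivative (bcurve f) (at t)"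

definition bnormal :: "(complex \<Rightarrow> real^3) \<Rightarrow> real \<Rightarrow> real^3" where
  "bnormal N t = N (cis t)"

definition bconormal :: "(complex \<Rightarrow> real^3) \<Rightarrow> (complex \<Rightarrow> real^3) \<Rightarrow> real \<Rightarrow> real^3" where
  "bconormal f N t = cross3 (bnormal N t) (btangent f t)"

definition normal_curv :: "(complex \<Rightarrow> real^3) \<Rightarrow> (complex \<Rightarrow> real^3) \<Rightarrow> real \<Rightarrow> real" where
  "normal_curv f N t = (vector_derivative (btangent f) (at t) \<bullet> bnormal N t)
       / norm (vector_derivative (bcurve f) (at t))"

definition geod_torsion :: "(complex \<Rightarrow> real^3) \<Rightarrow> (complex \<Rightarrow> real^3) \<Rightarrow> real \<Rightarrow> real" where
  "geod_torsion f N t = (vector_derivative (bconormal f N) (at t) \<bullet> bnormal N t)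
       / norm (vector_derivative (bcurve f) (at t))"

end

theory Submission
  imports Defs "HOL-Complex_Analysis.Complex_Analysis"
begin

text \<open>Hopf's function \<open>\<phi> = 4 \<langle>f\<^sub>z\<^sub>z, N\<rangle>\<close> vanishes exactly at the umbilics and is holomorphic when
  \<open>H\<close> is constant. On the boundary circle \<open>\<kappa>\<^sub>n = H - Re (z\<^sup>2 \<phi>) / (2 \<nu>\<^sup>2)\<close> and
  \<open>\<tau>\<^sub>g = \<plusminus> Im (z\<^sup>2 \<phi>) / (2 \<nu>\<^sup>2)\<close>. Since \<open>z\<^sup>2 \<phi>\<close> has mean value \<open>0\<close> over the circle, neither its real nor
  its imaginary part can have a constant sign there unless \<open>\<phi> = 0\<close>.

  As \<open>f\<close> is only of class \<open>C\<^sup>2\<close>, Codazzi's equations are not available in their usual form. Instead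
  \<open>\<phi> dz = 2 \<langle>N, d(f\<^sub>x - i f\<^sub>y)\<rangle> - 2 H \<nu>\<^sup>2 dz'\<close>, with \<open>z'\<close> the conjugate of \<open>z\<close>, and the integrals of this
  form over triangles vanish by Goursat's argument, so that Morera's theorem applies.\<close>

section \<open>Holomorphy from closed forms with nonsmooth coefficients\<close>

text \<open>The fundamental theorem of calculus makes \<open>g b - g a\<close> the integral of
  \<open>g'\<close> along the segment, so the error is the integral of the pointwise discrepancy. As
  \<open>g'\<close> is only real-linear, the direction \<open>b - a\<close> enters the
  bound.\<close>

lemma segment_integral_approx_potential:
  fixes Q g :: "complex \<Rightarrow> complex" and g' :: "complex \<Rightarrow> complex \<Rightarrow> complex"
  assumes Q: "continuous_on (closed_segment a b) Q"
    and g: "\<And>z. z \<in> closed_segment a b \<Longrightarrow> (g has_derivative g' z) (at z)"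
    and bd: "\<And>z. z \<in> closed_segment a b \<Longrightarrow> norm (Q z * (b - a) - g' z (b - a)) \<le> B"
  shows "norm (contour_integral (linepath a b) Q - (g b - g a)) \<le> B"
proof -
  define l where "l = (\<lambda>t::real. linepath a b t)"
  have l: "l t \<in> closed_segment a b" if "t \<in> {0..1}" for t
    using that linepath_in_path unfolding l_def by blast
  have "(l has_vector_derivative (b - a)) (at t within {0..1})" for t
    unfolding l_def by (rule has_vector_derivative_linepath_within)
  then have "((g \<circ> l) has_vector_derivative g' (l t) (b - a)) (at t within {0..1})"
    if "t \<in> {0..1}" for t
    using vector_derivative_diff_chain_within[of l "b - a" t "{0..1}" g "g' (l t)"]
      has_derivative_at_withinI[OF g[OF l[OF that]]] by blast
  then have 1: "((\<lambda>t. g' (l t) (b - a)) has_integral ((g \<circ> l) 1 - (g \<circ> l) 0)) {0..1}"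
    by (intro fundamental_theorem_of_calculus) (simp_all only: atLeastAtMost_iff zero_le_one)
  have 2: "((\<lambda>t. Q (l t) * (b - a)) has_integral contour_integral (linepath a b) Q) {0..1}"
    using has_contour_integral_integral[OF contour_integrable_continuous_linepath[OF Q]]
    by (simp add: has_contour_integral_linepath l_def)
  have 3: "((\<lambda>t. Q (l t) * (b - a) - g' (l t) (b - a)) has_integral
      (contour_integral (linepath a b) Q - (g b - g a))) (cbox 0 1)"
    using has_integral_diff[OF 2 1] by (simp add: l_def linepath_0' linepath_1')
  have "B \<ge> 0"
    using bd[of a] norm_ge_zero order_trans by blast
  from has_integral_bound[OF this 3] show ?thesis
    using bd l by (simp add: cbox_interval)
qed

text \<open>A Goursat argument: the triangle integrals of a form that is exact up to an error
  \<open>o(\<bar>z - p\<bar>)\<close> near every point \<open>p\<close> vanish, by repeated quadrisection.\<close>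
lemma holomorphic_on_approx_potential:
  fixes Q :: "complex \<Rightarrow> complex"
  assumes "open S" and cont: "continuous_on S Q"
    and pot: "\<And>p. p \<in> S \<Longrightarrow> \<exists>g g'. \<forall>e>0. \<exists>d>0. \<forall>z\<in>ball p d.
       (g has_derivative g' z) (at z) \<and>
       (\<forall>w. norm (Q z * w - g' z w) \<le> e * norm (z - p) * norm w)"
  shows "Q holomorphic_on S"
proof -
  define J where "J = (\<lambda>(a, b, c). contour_integral (linepath a b) Q
      + contour_integral (linepath b c) Q + contour_integral (linepath c a) Q)"
  have "J (a, b, c) = 0" if S: "convex hull {a, b, c} \<subseteq> S" for a b c
  proof (rule ccontr)
    assume nz: "J (a, b, c) \<noteq> 0"
    \<comment> \<open>The summand 1 keeps \<open>K\<close> positive, the rest bounds every side, and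
      \<open>e\<close> is scaled so that the initial triangle meets the last clause of
      \<open>At 0\<close> with equality.\<close>
    define K where "K = 1 + dist a b + dist b c + dist c a"
    define e where "e = norm (J (a, b, c)) / K\<^sup>2"
    define hul where "hul = (\<lambda>(x, y, z). convex hull {x, y, z :: complex})"
    \<comment> \<open>Quadrisection halves the sides and costs the integral at most a factor 4, so a
      lower bound quadratic in the size survives every stage.\<close>
    define At where "At = (\<lambda>n::nat. \<lambda>(x, y, z). convex hull {x, y, z} \<subseteq> S \<and> dist x y \<le> K / 2 ^ n \<and>
        dist y z \<le> K / 2 ^ n \<and> dist z x \<le> K / 2 ^ n \<and> e * (K / 2 ^ n)\<^sup>2 \<le> norm (J (x, y, z)))"
    have "K > 0"
      unfolding K_def by (smt (verit) zero_le_dist)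
    then have "e > 0"
      using nz by (simp add: e_def)
    have "\<exists>T. \<forall>n. At n (T n) \<and> hul (T (Suc n)) \<subseteq> hul (T n)"
    proof (rule dependent_nat_choice)
      have "At 0 (a, b, c)"
        using S \<open>K > 0\<close> by (auto simp: At_def e_def K_def)
      then show "\<exists>t. At 0 t" ..
    next
      fix t n assume t: "At n t"
      obtain x y z where xyz: "t = (x, y, z)"
        by (cases t)
      have sub: "convex hull {x, y, z} \<subseteq> S"
        using t by (simp add: At_def xyz)
      obtain x' y' z' where h: "x' \<in> convex hull {x, y, z}" "y' \<in> convex hull {x, y, z}"
        "z' \<in> convex hull {x, y, z}" "dist x' y' \<le> K / 2 ^ n / 2" "dist y' z' \<le> K / 2 ^ n / 2"
        "dist z' x' \<le> K / 2 ^ n / 2" "e * (K / 2 ^ n / 2)\<^sup>2 \<le> norm (J (x', y', z'))"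
        using Cauchy_theorem_quadrisection[OF continuous_on_subset[OF cont sub], of "K / 2 ^ n" e] t
        by (auto simp: At_def xyz J_def)
      have "convex hull {x', y', z'} \<subseteq> convex hull {x, y, z}"
        using h by (intro hull_minimal) auto
      then have "At (Suc n) (x', y', z') \<and> hul (x', y', z') \<subseteq> hul t"
        using h sub by (auto simp: At_def xyz hul_def mult.commute)
      then show "\<exists>t'. At (Suc n) t' \<and> hul t' \<subseteq> hul t" ..
    qed
    then obtain T where T: "\<And>n. At n (T n)" and dec: "\<And>n. hul (T (Suc n)) \<subseteq> hul (T n)"
      by blast
    obtain p where p: "\<And>n. p \<in> hul (T n)"
    proof (rule bounded_closed_nest)
      show "closed (hul (T n))" for n
        by (auto simp: hul_def split_def compact_imp_closed finite_imp_compact_convex_hull)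
      show "hul (T n) \<subseteq> hul (T m)" if "m \<le> n" for m n
        using lift_Suc_antimono_le[of "\<lambda>n. hul (T n)"] dec that by blast
      show "bounded (hul (T 0))"
        by (auto simp: hul_def split_def finite_imp_bounded_convex_hull)
    qed (auto simp: hul_def split_def)
    have "p \<in> S"
      using p[of 0] T[of 0] by (cases "T 0") (auto simp: hul_def At_def)
    \<comment> \<open>Three sides contribute at most \<open>e' * r * r\<close> each, and 3/4 of
      \<open>e * r\<^sup>2\<close> is too little.\<close>
    define e' where "e' = e / 4"
    have "e' > 0"
      using \<open>e > 0\<close> by (simp add: e'_def)
    obtain g g' where pot': "\<forall>e>0. \<exists>d>0. \<forall>z\<in>ball p d. (g has_derivative g' z) (at z) \<and>
        (\<forall>w. norm (Q z * w - g' z w) \<le> e * norm (z - p) * norm w)"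
      using pot[OF \<open>p \<in> S\<close>] by blast
    obtain d where "d > 0" and d: "\<forall>z\<in>ball p d. (g has_derivative g' z) (at z) \<and>
        (\<forall>w. norm (Q z * w - g' z w) \<le> e' * norm (z - p) * norm w)"
      using pot'[rule_format, OF \<open>e' > 0\<close>] by blast
    then have g: "\<And>z. z \<in> ball p d \<Longrightarrow> (g has_derivative g' z) (at z)"
      and gQ: "\<And>z w. z \<in> ball p d \<Longrightarrow> norm (Q z * w - g' z w) \<le> e' * norm (z - p) * norm w"
      by blast+
    obtain n where "K / d < 2 ^ n"
      using real_arch_pow[of 2 "K / d"] by auto
    then have Kd: "K / 2 ^ n < d"
      using \<open>d > 0\<close> by (simp add: field_simps)
    define r where "r = K / 2 ^ n"
    have "r > 0"
      using \<open>K > 0\<close> by (simp add: r_def)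
    obtain x y z where xyz: "T n = (x, y, z)"
      by (cases "T n")
    have t: "convex hull {x, y, z} \<subseteq> S" "dist x y \<le> r" "dist y z \<le> r" "dist z x \<le> r"
      "e * r\<^sup>2 \<le> norm (J (x, y, z))" "p \<in> convex hull {x, y, z}"
      using T[of n] p[of n] by (auto simp: At_def xyz r_def hul_def)
    have near: "norm (v - p) \<le> r" if "v \<in> convex hull {x, y, z}" for v
      using triangle_points_closer[OF that t(6)] t(2-4) by (auto simp: dist_norm)
    have side: "norm (contour_integral (linepath u v) Q - (g v - g u)) \<le> e' * r * r"
      if uv: "u \<in> {x, y, z}" "v \<in> {x, y, z}" and len: "norm (v - u) \<le> r" for u v
    proof (rule segment_integral_approx_potential)
      have sub: "closed_segment u v \<subseteq> convex hull {x, y, z}"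
        using uv by (intro closed_segment_subset) (auto simp: hull_inc)
      show "continuous_on (closed_segment u v) Q"
        using cont continuous_on_subset sub t(1) by blast
      fix s assume s: "s \<in> closed_segment u v"
      then have nr: "norm (s - p) \<le> r"
        using near sub by blast
      then have sb: "s \<in> ball p d"
        using Kd by (simp add: r_def dist_norm norm_minus_commute)
      then show "(g has_derivative g' s) (at s)"
        by (rule g)
      have "norm (Q s * (v - u) - g' s (v - u)) \<le> e' * norm (s - p) * norm (v - u)"
        using gQ sb by blast
      also have "\<dots> \<le> e' * r * r"
        using nr len \<open>e' > 0\<close> \<open>r > 0\<close> by (intro mult_mono) auto
      finally show "norm (Q s * (v - u) - g' s (v - u)) \<le> e' * r * r" .
    qed
    \<comment> \<open>The potential differences telescope around the triangle, leaving only the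
      errors of the sides.\<close>
    have "J (x, y, z) = (contour_integral (linepath x y) Q - (g y - g x))
        + (contour_integral (linepath y z) Q - (g z - g y))
        + (contour_integral (linepath z x) Q - (g x - g z))"
      by (simp add: J_def)
    also have "norm \<dots> \<le> e' * r * r + e' * r * r + e' * r * r"
      using t(2-4) by (intro norm_triangle_mono side) (auto simp: dist_norm norm_minus_commute)
    also have "\<dots> < e * r\<^sup>2"
      using \<open>e > 0\<close> \<open>r > 0\<close> by (simp add: e'_def power2_eq_square)
    finally show False
      using t(5) by simp
  qed
  then have "Q analytic_on S"
    using cont \<open>open S\<close> by (intro Morera_triangle) (auto simp: J_def)
  then show ?thesis
    by (rule analytic_imp_holomorphic)
qed

text \<open>For the form \<open>\<omega> = B a du\<close> the symmetry assumption says that \<open>d\<omega> = B da \<and> du\<close> vanishes; since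
  \<open>du\<close> need not be differentiable, \<open>d\<omega>\<close> itself is not defined.\<close>
lemma holomorphic_on_closed_form:
  fixes Q :: "complex \<Rightarrow> complex"
    and a :: "complex \<Rightarrow> 'a::real_normed_vector" and u :: "complex \<Rightarrow> 'b::real_normed_vector"
    and B :: "'a \<Rightarrow> 'b \<Rightarrow> complex"
  assumes "open S" and cont: "continuous_on S Q" and "bounded_bilinear B"
    and Q: "\<And>z w. z \<in> S \<Longrightarrow> Q z * w = B (a z) (u' z w)"
    and a: "\<And>z. z \<in> S \<Longrightarrow> (a has_derivative a' z) (at z)"
    and u: "\<And>z. z \<in> S \<Longrightarrow> (u has_derivative u' z) (at z)"
    and u': "\<And>p e. p \<in> S \<Longrightarrow> e > 0 \<Longrightarrow>
        \<exists>d>0. \<forall>z\<in>ball p d. \<forall>w. norm (u' z w - u' p w) \<le> e * norm w"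
    and sym: "\<And>z v w. z \<in> S \<Longrightarrow> B (a' z v) (u' z w) = B (a' z w) (u' z v)"
  shows "Q holomorphic_on S"
proof (rule holomorphic_on_approx_potential[OF assms(1,2)])
  fix p assume p: "p \<in> S"
  interpret B: bounded_bilinear B by fact
  obtain M where M: "M > 0" "\<And>x y. norm (B x y) \<le> norm x * norm y * M"
    using B.pos_bounded by blast
  interpret a': bounded_linear "a' p"
    using a[OF p] by (rule has_derivative_bounded_linear)
  interpret u': bounded_linear "u' p"
    using u[OF p] by (rule has_derivative_bounded_linear)
  obtain A where A: "A > 0" "\<And>x. norm (a' p x) \<le> norm x * A"
    using a'.pos_bounded by blast
  obtain C where C: "C > 0" "\<And>x. norm (u' p x) \<le> norm x * C"
    using u'.pos_bounded by blast
  \<comment> \<open>A second order potential of the form at \<open>p\<close>. By \<open>sym\<close>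
    the two halves of the derivative of its quadratic term coincide, which gives
    \<open>g'\<close>.\<close>
  define g where "g = (\<lambda>z. B (a p) (u z) + (1/2) *\<^sub>R B (a' p (z - p)) (u' p (z - p)))"
  define g' where "g' = (\<lambda>z w. B (a p) (u' z w) + B (a' p (z - p)) (u' p w))"
  have dg: "(g has_derivative g' z) (at z)" if "z \<in> S" for z
  proof -
    have 1: "((\<lambda>z. B (a p) (u z)) has_derivative (\<lambda>w. B (a p) (u' z w))) (at z)"
      using B.bounded_linear_right u[OF that] by (rule bounded_linear.has_derivative)
    have "((\<lambda>z. z - p) has_derivative (\<lambda>w. w)) (at z)"
      by (auto intro!: derivative_eq_intros)
    then have 2: "((\<lambda>z. B (a' p (z - p)) (u' p (z - p))) has_derivative
        (\<lambda>w. B (a' p (z - p)) (u' p w) + B (a' p w) (u' p (z - p)))) (at z)"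
      by (intro B.FDERIV a'.has_derivative u'.has_derivative)
    have "(g has_derivative (\<lambda>w. B (a p) (u' z w) + (1/2) *\<^sub>R
        (B (a' p (z - p)) (u' p w) + B (a' p w) (u' p (z - p))))) (at z)"
      unfolding g_def by (intro has_derivative_add has_derivative_scaleR_right 1 2)
    moreover have "B (a' p w) (u' p (z - p)) = B (a' p (z - p)) (u' p w)" for w
      by (rule sym[OF p])
    ultimately show ?thesis
      by (simp add: g'_def[abs_def] flip: scaleR_2)
  qed
  have "\<exists>d>0. \<forall>z\<in>ball p d. (g has_derivative g' z) (at z) \<and>
       (\<forall>w. norm (Q z * w - g' z w) \<le> e * norm (z - p) * norm w)" if "e > 0" for e
  proof -
    \<comment> \<open>The bound 1 yields the constant \<open>C + 1\<close> for \<open>u' z\<close>;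
      the quotient makes the two error terms below sum to at most \<open>e\<close>.\<close>
    define e1 where "e1 = min 1 (e / (M * (C + 1 + A)))"
    have e1: "e1 > 0" "e1 \<le> 1"
      using \<open>e > 0\<close> M A C by (auto simp: e1_def)
    have "e1 * (M * (C + 1 + A)) \<le> e"
      using M A C by (simp add: e1_def min_def pos_le_divide_eq)
    then have e1e: "e1 * (C + 1) * M + A * e1 * M \<le> e"
      by (simp add: algebra_simps)
    from \<open>open S\<close> p obtain d1 where d1: "d1 > 0" "ball p d1 \<subseteq> S"
      by (meson openE)
    from u'[OF p e1(1)] obtain d2 where d2: "d2 > 0"
      "\<And>z w. z \<in> ball p d2 \<Longrightarrow> norm (u' z w - u' p w) \<le> e1 * norm w"
      by blast
    from a[OF p] e1(1) obtain d3 where d3: "d3 > 0"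
      "\<And>z. norm (z - p) < d3 \<Longrightarrow> norm (a z - a p - a' p (z - p)) \<le> e1 * norm (z - p)"
      unfolding has_derivative_at_alt by blast
    define d where "d = min d1 (min d2 d3)"
    have "norm (Q z * w - g' z w) \<le> e * norm (z - p) * norm w" if z: "z \<in> ball p d" for z w
    proof -
      have near: "z \<in> ball p d1" "z \<in> ball p d2" "norm (z - p) < d3"
        using z by (auto simp: d_def dist_norm norm_minus_commute)
      have zS: "z \<in> S" and z2: "norm (u' z w - u' p w) \<le> e1 * norm w"
        and z3: "norm (a z - a p - a' p (z - p)) \<le> e1 * norm (z - p)"
        using near d1(2) d2(2) d3(2) by blast+
      have "norm (u' z w) \<le> norm (u' z w - u' p w) + norm (u' p w)"
        using norm_triangle_ineq[of "u' z w - u' p w" "u' p w"] by simp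
      also have "\<dots> \<le> 1 * norm w + norm w * C"
        using e1 by (intro add_mono C order_trans[OF z2] mult_right_mono) auto
      finally have uz: "norm (u' z w) \<le> (C + 1) * norm w"
        by (simp add: algebra_simps)
      \<comment> \<open>The first term carries the Taylor remainder of \<open>a\<close>, the second
        the oscillation of \<open>u'\<close> against the linear part of \<open>a\<close>; both are
        \<open>o(norm (z - p))\<close>.\<close>
      have "Q z * w - g' z w = B (a z - a p - a' p (z - p)) (u' z w)
          + B (a' p (z - p)) (u' z w - u' p w)"
        by (simp add: Q[OF zS] g'_def B.diff_left B.diff_right)
      also have "norm \<dots> \<le> norm (a z - a p - a' p (z - p)) * norm (u' z w) * M
          + norm (a' p (z - p)) * norm (u' z w - u' p w) * M"
        by (intro norm_triangle_mono M)
      also have "\<dots> \<le> (e1 * norm (z - p)) * ((C + 1) * norm w) * M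
          + (norm (z - p) * A) * (e1 * norm w) * M"
        using M(1) A(1) C(1) e1 by (intro add_mono mult_right_mono mult_mono z2 z3 uz A(2)) auto
      also have "\<dots> = (e1 * (C + 1) * M + A * e1 * M) * (norm (z - p) * norm w)"
        by (simp add: algebra_simps)
      also have "\<dots> \<le> e * (norm (z - p) * norm w)"
        using e1e by (rule mult_right_mono) simp
      finally show ?thesis
        by (simp add: mult.assoc)
    qed
    moreover have "ball p d \<subseteq> S" "d > 0"
      using d1 d2 d3 by (auto simp: d_def)
    ultimately show ?thesis
      using dg by blast
  qed
  then show "\<exists>g g'. \<forall>e>0. \<exists>d>0. \<forall>z\<in>ball p d. (g has_derivative g' z) (at z) \<and>
       (\<forall>w. norm (Q z * w - g' z w) \<le> e * norm (z - p) * norm w)"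
    by blast
qed

section \<open>Sign conditions on the unit circle\<close>

text \<open>On the circle \<open>dz = 2 pi i z dt\<close>, so Cauchy's theorem for \<open>q\<close>
  says that \<open>z * q z\<close> has mean value zero. A continuous nonnegative function with zero
  integral vanishes.\<close>

lemma Re_zero_on_circle:
  assumes q: "q holomorphic_on U" and U: "cball 0 1 \<subseteq> U"
    and nonneg: "\<And>z. z \<in> sphere 0 1 \<Longrightarrow> 0 \<le> Re (z * q z)" and z: "z \<in> sphere 0 1"
  shows "Re (z * q z) = 0"
proof -
  define c where "c = circlepath 0 1"
  have c: "c t \<in> sphere 0 1" for t
    by (simp add: c_def circlepath)
  have q': "q holomorphic_on cball 0 1"
    using q U by (rule holomorphic_on_subset)
  then have "(q has_contour_integral 0) c"
    by (rule Cauchy_theorem_convex_simple) (auto simp: c_def)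
  then have "((\<lambda>t. q (c t) * vector_derivative c (at t)) has_integral 0) {0..1}"
    by (simp add: has_contour_integral)
  moreover have "q (c t) * vector_derivative c (at t) = \<i> * (of_real (2 * pi) * (c t * q (c t)))" for t
    unfolding c_def vector_derivative_circlepath by (simp add: circlepath algebra_simps)
  ultimately have "((\<lambda>t. \<i> * (of_real (2 * pi) * (c t * q (c t)))) has_integral 0) {0..1}"
    by simp
  moreover have "Im (\<i> * (of_real r * w)) = r * Re w" for r w
    by simp
  ultimately have "((\<lambda>t. 2 * pi * Re (c t * q (c t))) has_integral 0) {0..1}"
    using has_integral_Im[of "\<lambda>t. \<i> * (of_real (2 * pi) * (c t * q (c t)))" 0 "{0..1}"]
    by (simp only: zero_complex.sel)
  then have int: "((\<lambda>t. 2 * pi * Re (c t * q (c t))) has_integral 0) (cbox 0 1)"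
    by (simp add: cbox_interval)
  have contc: "continuous_on {0..1} c"
    using path_circlepath[of 0 1] by (simp add: path_def c_def)
  have "c ` {0..1} \<subseteq> cball 0 1"
    using c by (auto simp: less_eq_real_def)
  then have "continuous_on {0..1} (\<lambda>t. q (c t))"
    by (rule continuous_on_compose2[OF holomorphic_on_imp_continuous_on[OF q'] contc])
  then have "continuous_on {0..1} (\<lambda>t. 2 * pi * Re (c t * q (c t)))"
    by (intro continuous_on_mult continuous_on_const continuous_on_Re contc)
  then have zero: "2 * pi * Re (c t * q (c t)) = 0" if "t \<in> cbox 0 1" for t
    by (intro has_integral_0_cbox_imp_0[OF _ _ int _ that]) (use nonneg c in \<open>auto simp: cbox_interval\<close>)
  have "z \<in> c ` {0..1}"
    using z path_image_circlepath[of 0 1] by (simp add: c_def path_image_def)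
  then obtain t where "t \<in> {0..1}" "z = c t"
    by blast
  with zero[of t] show ?thesis
    by (simp add: cbox_interval)
qed

text \<open>The first application of the mean value property gives \<open>Re h = 0\<close> on the circle for
  \<open>h = k z\<^sup>2 Q\<close>; then \<open>Re (- h\<^sup>2) = (Im h)\<^sup>2\<close> there, and a second application gives \<open>Im h = 0\<close>.\<close>
lemma holomorphic_zero_from_boundary_sign:
  assumes Q: "Q holomorphic_on U" and U: "cball 0 1 \<subseteq> U" and "k \<noteq> 0"
    and nonneg: "\<And>z. z \<in> sphere 0 1 \<Longrightarrow> 0 \<le> Re (k * z\<^sup>2 * Q z)" and z: "z \<in> cball 0 1"
  shows "Q z = 0"
proof -
  have Re0: "Re (k * z\<^sup>2 * Q z) = 0" if "z \<in> sphere 0 1" for z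
  proof -
    \<comment> \<open>One factor \<open>z\<close> is split off for the mean value property; the
      other stays in the holomorphic function.\<close>
    have eq: "k * z\<^sup>2 * Q z = z * (k * z * Q z)" for z
      by (simp add: power2_eq_square)
    show ?thesis
      unfolding eq
    proof (rule Re_zero_on_circle[OF _ U _ that])
      show "(\<lambda>z. k * z * Q z) holomorphic_on U"
        using Q by (intro holomorphic_intros)
    qed (use nonneg in \<open>simp only: eq\<close>)
  qed
  \<comment> \<open>With \<open>h = k * z\<^sup>2 * Q z\<close>, the function
    \<open>- h\<^sup>2\<close> contains \<open>z ^ 4\<close>, so a factor \<open>z\<close> can be
    split off again.\<close>
  have sq: "z * - (k\<^sup>2 * z ^ 3 * (Q z)\<^sup>2) = - ((k * z\<^sup>2 * Q z)\<^sup>2)" for z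
    by (simp add: power2_eq_square power3_eq_cube)
  have "Re (z * - (k\<^sup>2 * z ^ 3 * (Q z)\<^sup>2)) = 0" if "z \<in> sphere 0 1" for z
  proof (rule Re_zero_on_circle[OF _ U _ that])
    show "(\<lambda>z. - (k\<^sup>2 * z ^ 3 * (Q z)\<^sup>2)) holomorphic_on U"
      using Q by (intro holomorphic_intros)
    fix z :: complex assume "z \<in> sphere 0 1"
    from Re0[OF this] show "0 \<le> Re (z * - (k\<^sup>2 * z ^ 3 * (Q z)\<^sup>2))"
      unfolding sq uminus_complex.sel Re_power2 by simp
  qed
  then have "Im (k * z\<^sup>2 * Q z) = 0" if "z \<in> sphere 0 1" for z
    using Re0[OF that] that unfolding sq uminus_complex.sel Re_power2 by fastforce
  with Re0 have "k * z\<^sup>2 * Q z = 0" if "z \<in> sphere 0 1" for z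
    using that by (intro complex_eqI) (simp_all only: zero_complex.sel)
  then have 0: "Q z = 0" if "z \<in> sphere 0 1" for z
    using that \<open>k \<noteq> 0\<close> by fastforce
  \<comment> \<open>The maximum modulus principle carries the vanishing from the circle into the
    disc.\<close>
  have "norm (Q z) \<le> 0"
  proof (rule maximum_modulus_frontier[OF _ _ bounded_cball _ z])
    show "Q holomorphic_on interior (cball 0 1)"
      using Q U by (meson holomorphic_on_subset interior_subset)
    show "continuous_on (closure (cball 0 1)) Q"
      using holomorphic_on_imp_continuous_on[OF Q] U by (simp add: continuous_on_subset)
  qed (use 0 in \<open>auto simp: frontier_cball\<close>)
  then show ?thesis
    by simp
qed

section \<open>Partial derivatives\<close>

text \<open>The mean value theorem is applied twice: along \<open>u\<close> to the difference of
  \<open>g\<close> between opposite edges of the parallelogram, then along \<open>v\<close> to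
  \<open>g' _ u\<close>.\<close>

lemma second_difference_mvt:
  fixes g :: "'a::real_normed_vector \<Rightarrow> real"
  assumes "s > 0"
    and g: "\<And>z. z \<in> S \<Longrightarrow> (g has_derivative g' z) (at z)"
    and gu: "\<And>z. z \<in> S \<Longrightarrow> ((\<lambda>z. g' z u) has_derivative gu' z) (at z)"
    and S: "\<And>a b. a \<in> {0..s} \<Longrightarrow> b \<in> {0..s} \<Longrightarrow> p + a *\<^sub>R u + b *\<^sub>R v \<in> S"
  obtains a b where "a \<in> {0..s}" "b \<in> {0..s}"
    "g (p + s *\<^sub>R u + s *\<^sub>R v) - g (p + s *\<^sub>R u) - g (p + s *\<^sub>R v) + g p
      = s * s * gu' (p + a *\<^sub>R u + b *\<^sub>R v) v"
proof -
  have du: "((\<lambda>a. g (p + a *\<^sub>R u + b *\<^sub>R v)) has_real_derivative g' (p + a *\<^sub>R u + b *\<^sub>R v) u) (at a)"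
    if "a \<in> {0..s}" "b \<in> {0..s}" for a b
  proof -
    have "((\<lambda>a. p + a *\<^sub>R u + b *\<^sub>R v) has_derivative (\<lambda>h. h *\<^sub>R u)) (at a)"
      by (auto intro!: derivative_eq_intros)
    from has_derivative_compose[OF this g[OF S[OF that]]] show ?thesis
      by (simp add: has_field_derivative_def mult_commute_abs
          linear_cmul[OF has_derivative_linear[OF g[OF S[OF that]]]])
  qed
  have dv: "((\<lambda>b. g' (p + a *\<^sub>R u + b *\<^sub>R v) u) has_real_derivative gu' (p + a *\<^sub>R u + b *\<^sub>R v) v) (at b)"
    if "a \<in> {0..s}" "b \<in> {0..s}" for a b
  proof -
    have "((\<lambda>b. p + a *\<^sub>R u + b *\<^sub>R v) has_derivative (\<lambda>h. h *\<^sub>R v)) (at b)"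
      by (auto intro!: derivative_eq_intros)
    from has_derivative_compose[OF this gu[OF S[OF that]]] show ?thesis
      by (simp add: has_field_derivative_def mult_commute_abs
          linear_cmul[OF has_derivative_linear[OF gu[OF S[OF that]]]])
  qed
  define \<phi> where "\<phi> = (\<lambda>a. g (p + a *\<^sub>R u + s *\<^sub>R v) - g (p + a *\<^sub>R u + 0 *\<^sub>R v))"
  have "DERIV \<phi> a :> g' (p + a *\<^sub>R u + s *\<^sub>R v) u - g' (p + a *\<^sub>R u + 0 *\<^sub>R v) u" if "0 \<le> a" "a \<le> s" for a
    unfolding \<phi>_def using that \<open>s > 0\<close> by (intro DERIV_diff du) auto
  from MVT2[OF \<open>s > 0\<close> this] obtain a where a: "0 < a" "a < s"
    "\<phi> s - \<phi> 0 = (s - 0) * (g' (p + a *\<^sub>R u + s *\<^sub>R v) u - g' (p + a *\<^sub>R u + 0 *\<^sub>R v) u)"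
    by blast
  have "DERIV (\<lambda>b. g' (p + a *\<^sub>R u + b *\<^sub>R v) u) b :> gu' (p + a *\<^sub>R u + b *\<^sub>R v) v"
    if "0 \<le> b" "b \<le> s" for b
    using that a by (intro dv) auto
  from MVT2[OF \<open>s > 0\<close> this] obtain b where b: "0 < b" "b < s"
    "g' (p + a *\<^sub>R u + s *\<^sub>R v) u - g' (p + a *\<^sub>R u + 0 *\<^sub>R v) u = (s - 0) * gu' (p + a *\<^sub>R u + b *\<^sub>R v) v"
    by blast
  show thesis
    using a b by (intro that[of a b]) (simp_all add: \<phi>_def)
qed

text \<open>The second difference is symmetric in \<open>u\<close> and \<open>v\<close>, so it
  equals \<open>s * s\<close> times either mixed derivative at some point of the parallelogram.
  Continuity at \<open>p\<close> finishes the argument as the parallelogram shrinks.\<close>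

lemma mixed_derivatives_commute_real:
  fixes g :: "'a::real_normed_vector \<Rightarrow> real"
  assumes "open S" "p \<in> S"
    and g: "\<And>z. z \<in> S \<Longrightarrow> (g has_derivative g' z) (at z)"
    and gu: "\<And>z. z \<in> S \<Longrightarrow> ((\<lambda>z. g' z u) has_derivative gu' z) (at z)"
    and gv: "\<And>z. z \<in> S \<Longrightarrow> ((\<lambda>z. g' z v) has_derivative gv' z) (at z)"
    and cont: "continuous_on S (\<lambda>z. gu' z v)" "continuous_on S (\<lambda>z. gv' z u)"
  shows "gu' p v = gv' p u"
proof (rule ccontr)
  assume ne: "gu' p v \<noteq> gv' p u"
  define e where "e = \<bar>gu' p v - gv' p u\<bar> / 2"
  have "e > 0"
    using ne by (simp add: e_def)
  obtain d0 where d0: "d0 > 0" "ball p d0 \<subseteq> S"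
    using \<open>open S\<close> \<open>p \<in> S\<close> by (meson openE)
  obtain d1 where d1: "d1 > 0" "\<And>z. z \<in> S \<Longrightarrow> dist z p < d1 \<Longrightarrow> \<bar>gu' z v - gu' p v\<bar> < e"
    using cont(1) \<open>p \<in> S\<close> \<open>e > 0\<close> unfolding continuous_on_iff dist_real_def by meson
  obtain d2 where d2: "d2 > 0" "\<And>z. z \<in> S \<Longrightarrow> dist z p < d2 \<Longrightarrow> \<bar>gv' z u - gv' p u\<bar> < e"
    using cont(2) \<open>p \<in> S\<close> \<open>e > 0\<close> unfolding continuous_on_iff dist_real_def by meson
  define d where "d = min d0 (min d1 d2)"
  \<comment> \<open>This keeps the parallelogram inside the ball of radius \<open>d\<close>; the
    summand 1 makes the denominator positive and the inclusion strict.\<close>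
  define s where "s = d / (norm u + norm v + 1)"
  have "d > 0"
    using d0 d1 d2 by (simp add: d_def)
  moreover have pos: "norm u + norm v + 1 > 0"
    by (smt (verit) norm_ge_zero)
  ultimately have "s > 0"
    by (simp add: s_def)
  have near: "dist (p + a *\<^sub>R u + b *\<^sub>R v) p < d" if "a \<in> {0..s}" "b \<in> {0..s}" for a b
  proof -
    have "dist (p + a *\<^sub>R u + b *\<^sub>R v) p = norm (a *\<^sub>R u + b *\<^sub>R v)"
      by (simp add: dist_norm add.assoc)
    also have "\<dots> \<le> a * norm u + b * norm v"
      using norm_triangle_ineq[of "a *\<^sub>R u" "b *\<^sub>R v"] that by simp
    also have "\<dots> \<le> s * norm u + s * norm v"
      using that by (intro add_mono mult_right_mono) auto
    also have "\<dots> < s * (norm u + norm v + 1)"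
      using \<open>s > 0\<close> by (simp add: algebra_simps)
    also have "\<dots> = d"
      using pos by (simp add: s_def)
    finally show ?thesis .
  qed
  have inS: "p + a *\<^sub>R u + b *\<^sub>R v \<in> S" if "a \<in> {0..s}" "b \<in> {0..s}" for a b
    using near[OF that] d0(2) by (auto simp: d_def dist_commute)
  have inS': "p + a *\<^sub>R v + b *\<^sub>R u \<in> S" if "a \<in> {0..s}" "b \<in> {0..s}" for a b
    using inS[OF that(2,1)] by (simp add: add_ac)
  obtain a b where ab: "a \<in> {0..s}" "b \<in> {0..s}"
    "g (p + s *\<^sub>R u + s *\<^sub>R v) - g (p + s *\<^sub>R u) - g (p + s *\<^sub>R v) + g p
      = s * s * gu' (p + a *\<^sub>R u + b *\<^sub>R v) v"
    using second_difference_mvt[OF \<open>s > 0\<close> g gu inS] by blast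
  obtain a' b' where ab': "a' \<in> {0..s}" "b' \<in> {0..s}"
    "g (p + s *\<^sub>R v + s *\<^sub>R u) - g (p + s *\<^sub>R v) - g (p + s *\<^sub>R u) + g p
      = s * s * gv' (p + a' *\<^sub>R v + b' *\<^sub>R u) u"
    using second_difference_mvt[OF \<open>s > 0\<close> g gv inS'] by blast
  have "s * s * gu' (p + a *\<^sub>R u + b *\<^sub>R v) v = s * s * gv' (p + a' *\<^sub>R v + b' *\<^sub>R u) u"
    using ab(3) ab'(3) unfolding add.assoc[of p] add.commute[of "s *\<^sub>R v"] by linarith
  then have "gu' (p + a *\<^sub>R u + b *\<^sub>R v) v = gv' (p + a' *\<^sub>R v + b' *\<^sub>R u) u"
    using \<open>s > 0\<close> by simp
  moreover have "\<bar>gu' (p + a *\<^sub>R u + b *\<^sub>R v) v - gu' p v\<bar> < e"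
    using near[OF ab(1,2)] by (intro d1 inS ab) (simp add: d_def)
  moreover have "\<bar>gv' (p + a' *\<^sub>R v + b' *\<^sub>R u) u - gv' p u\<bar> < e"
    using near[OF ab'(2,1)] by (intro d2 inS' ab') (simp add: d_def add_ac)
  ultimately have "\<bar>gu' p v - gv' p u\<bar> < e + e"
    by linarith
  then show False
    by (simp add: e_def)
qed

text \<open>The mean value theorem is a scalar statement, so the values are tested against every
  fixed vector \<open>x\<close>.\<close>

lemma mixed_derivatives_commute:
  fixes g :: "'a::real_normed_vector \<Rightarrow> 'b::real_inner"
  assumes "open S" "p \<in> S"
    and g: "\<And>z. z \<in> S \<Longrightarrow> (g has_derivative g' z) (at z)"
    and gu: "\<And>z. z \<in> S \<Longrightarrow> ((\<lambda>z. g' z u) has_derivative gu' z) (at z)"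
    and gv: "\<And>z. z \<in> S \<Longrightarrow> ((\<lambda>z. g' z v) has_derivative gv' z) (at z)"
    and cont: "continuous_on S (\<lambda>z. gu' z v)" "continuous_on S (\<lambda>z. gv' z u)"
  shows "gu' p v = gv' p u"
proof -
  have "gu' p v \<bullet> x = gv' p u \<bullet> x" for x
    by (rule mixed_derivatives_commute_real[OF assms(1,2), of "\<lambda>z. g z \<bullet> x" "\<lambda>z w. g' z w \<bullet> x"
          u "\<lambda>z w. gu' z w \<bullet> x" v "\<lambda>z w. gv' z w \<bullet> x"])
       (auto intro!: has_derivative_inner_left g gu gv continuous_intros cont)
  then show ?thesis
    by (metis vector_eq_rdot)
qed

text \<open>Restricting the total derivative to the lines through \<open>z\<close> in the directions
  \<open>1\<close> and \<open>\<i>\<close> identifies its values there with the partials; real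
  linearity gives the rest.\<close>

lemma has_derivative_pd:
  assumes "g differentiable (at z)"
  shows "(g has_derivative (\<lambda>w. Re w *\<^sub>R pdx g z + Im w *\<^sub>R pdy g z)) (at z)"
proof -
  obtain D where D: "(g has_derivative D) (at z)"
    using assms unfolding differentiable_def by blast
  interpret D: bounded_linear D
    using D by (rule has_derivative_bounded_linear)
  have *: "((\<lambda>t. g (z + c * complex_of_real t)) has_vector_derivative D c) (at 0)" for c
  proof -
    have "((\<lambda>t. z + c * complex_of_real t) has_derivative (\<lambda>h. c * complex_of_real h)) (at 0)"
      by (auto intro!: derivative_eq_intros)
    from has_derivative_compose[OF this, of g D] D
    have "((\<lambda>t. g (z + c * complex_of_real t)) has_derivative (\<lambda>h. D (c * complex_of_real h))) (at 0)"
      by simp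
    moreover have "c * complex_of_real h = h *\<^sub>R c" for h
      by (simp add: scaleR_conv_of_real)
    ultimately show ?thesis
      by (simp add: has_vector_derivative_def D.scaleR)
  qed
  have "pdx g z = D 1" "pdy g z = D \<i>"
    using vector_derivative_at[OF *[of 1]] vector_derivative_at[OF *[of \<i>]]
    by (simp_all add: pdx_def pdy_def)
  moreover have "D w = Re w *\<^sub>R D 1 + Im w *\<^sub>R D \<i>" for w
  proof -
    have "w = Re w *\<^sub>R 1 + Im w *\<^sub>R \<i>"
      by (simp add: complex_eq_iff)
    then have "D w = D (Re w *\<^sub>R 1 + Im w *\<^sub>R \<i>)"
      by simp
    then show ?thesis
      by (simp only: D.add D.scaleR)
  qed
  then have "D = (\<lambda>w. Re w *\<^sub>R D 1 + Im w *\<^sub>R D \<i>)"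
    by (rule ext)
  ultimately show ?thesis
    using D by simp
qed

text \<open>This serves to differentiate identities that hold only on \<open>U\<close>.\<close>

lemma has_derivative_zero_on_open:
  assumes "open U" "z \<in> U" "\<And>z. z \<in> U \<Longrightarrow> h z = c" "(h has_derivative D) (at z)"
  shows "D w = 0"
proof -
  have "((\<lambda>_. c) has_derivative D) (at z)"
    using assms(4,1,2) by (rule has_derivative_transform_within_open) (simp add: assms(3))
  from has_derivative_unique[OF this has_derivative_const] show ?thesis
    by simp
qed

lemma has_vector_derivative_along_circle:
  assumes "g differentiable (at (cis t))"
  shows "((\<lambda>t. g (cis t)) has_vector_derivative
    (- sin t) *\<^sub>R pdx g (cis t) + cos t *\<^sub>R pdy g (cis t)) (at t)"
proof -
  have "(cis has_derivative (\<lambda>h. h *\<^sub>R (\<i> * cis t))) (at t)"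
    using has_derivative_cis[OF has_derivative_ident] .
  from has_derivative_compose[OF this has_derivative_pd[OF assms]] show ?thesis
    by (simp add: has_vector_derivative_def scaleR_add_right scaleR_right_diff_distrib)
qed

section \<open>Conformal immersions\<close>

text \<open>Parseval's identity for the frame \<open>F\<close>, \<open>G\<close>, \<open>N\<close>,
  cleared of denominators. The residual \<open>v\<close> of \<open>x\<close> is orthogonal to
  \<open>F\<close> and \<open>G\<close>, hence parallel to \<open>c\<close>; it is also orthogonal
  to \<open>N\<close>, a nonzero multiple of \<open>c\<close>, and so vanishes.\<close>

lemma orthogonal_frame_expansion:
  fixes F G N x y :: "real^3"
  assumes F: "F \<bullet> F = m" and G: "G \<bullet> G = m" and "m > 0" and FG: "F \<bullet> G = 0"
    and N: "N \<bullet> N = 1" "N \<bullet> F = 0" "N \<bullet> G = 0"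
  shows "m * (x \<bullet> y) = (x \<bullet> F) * (y \<bullet> F) + (x \<bullet> G) * (y \<bullet> G) + m * (x \<bullet> N) * (y \<bullet> N)"
proof -
  define c where "c = cross3 F G"
  have c0: "cross3 c v = 0" if "v \<bullet> F = 0" "v \<bullet> G = 0" for v
  proof -
    have "cross3 c v = (v \<bullet> F) *\<^sub>R G - (v \<bullet> G) *\<^sub>R F"
      by (simp add: c_def cross3_simps forall_3)
    then show ?thesis
      using that by simp
  qed
  have "(c \<bullet> c) *\<^sub>R N - (c \<bullet> N) *\<^sub>R c = - cross3 c (cross3 c N)"
    by (simp add: cross3_simps forall_3)
  then have Nc: "(c \<bullet> c) *\<^sub>R N = (c \<bullet> N) *\<^sub>R c"
    using c0[OF N(2,3)] by simp
  have "(norm c)\<^sup>2 = m * m"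
    using norm_cross_dot[of F G] F G FG by (simp add: c_def power_mult_distrib power2_norm_eq_inner)
  then have cc: "c \<bullet> c = m * m"
    by (simp add: power2_norm_eq_inner)
  define v where "v = x - ((x \<bullet> F) / m) *\<^sub>R F - ((x \<bullet> G) / m) *\<^sub>R G - (x \<bullet> N) *\<^sub>R N"
  have v: "v \<bullet> F = 0" "v \<bullet> G = 0" "v \<bullet> N = 0"
    using F G FG N \<open>m > 0\<close>
    by (simp_all add: v_def inner_diff_left inner_commute[of G F] inner_commute[of F N] inner_commute[of G N])
  have "c \<bullet> N \<noteq> 0"
  proof
    assume "c \<bullet> N = 0"
    with Nc cc \<open>m > 0\<close> have "N = 0" by simp
    with N(1) show False by simp
  qed
  moreover have "(c \<bullet> N) * (c \<bullet> v) = 0"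
    using arg_cong[OF Nc, of "\<lambda>a. a \<bullet> v"] v(3) by (simp add: inner_commute)
  ultimately have "c \<bullet> v = 0" by simp
  with c0[OF v(1,2)] have "c = 0 \<or> v = 0"
    using norm_and_cross_eq_0 by blast
  then have "v = 0"
    using cc \<open>m > 0\<close> by auto
  then have "x = ((x \<bullet> F) / m) *\<^sub>R F + ((x \<bullet> G) / m) *\<^sub>R G + (x \<bullet> N) *\<^sub>R N"
    by (simp add: v_def algebra_simps)
  from arg_cong[OF this, of "\<lambda>a. m *\<^sub>R a"]
  have "m *\<^sub>R x = (x \<bullet> F) *\<^sub>R F + (x \<bullet> G) *\<^sub>R G + (m * (x \<bullet> N)) *\<^sub>R N"
    using \<open>m > 0\<close> by (simp add: scaleR_add_right)
  from arg_cong[OF this, of "\<lambda>a. a \<bullet> y"] show ?thesis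
    by (simp only: inner_add_left inner_scaleR_left inner_commute[of F y] inner_commute[of G y]
        inner_commute[of N y] mult.assoc)
qed

locale conformal_immersion =
  fixes U :: "complex set" and f N :: "complex \<Rightarrow> real^3"
  assumes open_U: "open U" and C2: "C2_on U f" and conformal: "conformal_on U f"
    and normal: "unit_normal_field U f N"
begin

abbreviation "fx \<equiv> pdx f"
abbreviation "fy \<equiv> pdy f"

definition "\<nu>2 z = fx z \<bullet> fx z"
text \<open>\<open>L\<close>, \<open>M\<close>, \<open>G\<close> are the coefficients of the second
  fundamental form, and \<open>hopf\<close> is Hopf's function \<open>\<phi>\<close>.\<close>

definition "L z = pdx fx z \<bullet> N z"
definition "M z = pdy fx z \<bullet> N z"
definition "G z = pdy fy z \<bullet> N z"
definition "hopf z = Complex (L z - G z) (- 2 * M z)"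

lemma diff: "f differentiable (at z)" "fx differentiable (at z)" "fy differentiable (at z)" if "z \<in> U"
  using C2 that by (auto simp: C2_on_def)

lemma metric: "\<nu>2 z > 0" "fx z \<bullet> fx z = \<nu>2 z" "fy z \<bullet> fy z = \<nu>2 z" "fx z \<bullet> fy z = 0" "fy z \<bullet> fx z = 0" if "z \<in> U"
  using conformal that by (auto simp: conformal_on_def \<nu>2_def inner_commute)

lemma unit_normal: "N z \<bullet> N z = 1" "N z \<bullet> fx z = 0" "N z \<bullet> fy z = 0" "fx z \<bullet> N z = 0" "fy z \<bullet> N z = 0" if "z \<in> U"
  using normal that by (auto simp: unit_normal_field_def norm_eq_1 inner_commute)

lemma continuous_on_N: "continuous_on U N"
  using normal by (simp add: unit_normal_field_def)

lemma continuous_on_diff: "continuous_on U fx" "continuous_on U fy"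
  using diff open_U by (auto intro!: continuous_at_imp_continuous_on differentiable_imp_continuous_within)

lemma continuous_on_diff2: "continuous_on U (pdx fx)" "continuous_on U (pdy fx)"
  "continuous_on U (pdx fy)" "continuous_on U (pdy fy)"
  using C2 by (auto simp: C2_on_def)

text \<open>\<open>C2_on\<close> provides continuity of all four second partials but not the
  equality of the mixed ones; it follows from \<open>mixed_derivatives_commute\<close> in the
  directions \<open>1\<close> and \<open>\<i>\<close>.\<close>

lemma pdx_fy: "pdx fy z = pdy fx z" if "z \<in> U"
proof -
  have "Re 1 *\<^sub>R pdx fy z + Im 1 *\<^sub>R pdy fy z = Re \<i> *\<^sub>R pdx fx z + Im \<i> *\<^sub>R pdy fx z"
  proof (rule sym, rule mixed_derivatives_commute[OF open_U that, of f
        "\<lambda>z w. Re w *\<^sub>R fx z + Im w *\<^sub>R fy z" 1 "\<lambda>z w. Re w *\<^sub>R pdx fx z + Im w *\<^sub>R pdy fx z"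
        \<i> "\<lambda>z w. Re w *\<^sub>R pdx fy z + Im w *\<^sub>R pdy fy z"])
    fix z assume "z \<in> U"
    note d = diff[OF this, THEN has_derivative_pd]
    show "(f has_derivative (\<lambda>w. Re w *\<^sub>R fx z + Im w *\<^sub>R fy z)) (at z)"
      by (rule d(1))
    show "((\<lambda>z. Re 1 *\<^sub>R fx z + Im 1 *\<^sub>R fy z) has_derivative
        (\<lambda>w. Re w *\<^sub>R pdx fx z + Im w *\<^sub>R pdy fx z)) (at z)"
      using d(2) by simp
    show "((\<lambda>z. Re \<i> *\<^sub>R fx z + Im \<i> *\<^sub>R fy z) has_derivative
        (\<lambda>w. Re w *\<^sub>R pdx fy z + Im w *\<^sub>R pdy fy z)) (at z)"
      using d(3) by simp
  qed (simp_all add: continuous_on_diff2)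
  then show ?thesis
    by simp
qed

text \<open>\<open>N = \<plusminus> n\<close>, which yields the differentiability of \<open>N\<close>.\<close>
definition "n z = (1 / \<nu>2 z) *\<^sub>R cross3 (fx z) (fy z)"

lemma n_unit: "n z \<bullet> n z = 1" "n z \<bullet> fx z = 0" "n z \<bullet> fy z = 0" if "z \<in> U"
proof -
  have "(norm (cross3 (fx z) (fy z)))\<^sup>2 = \<nu>2 z * \<nu>2 z"
    using norm_cross_dot[of "fx z" "fy z"] metric[OF that]
    by (simp add: power_mult_distrib power2_norm_eq_inner)
  then have "cross3 (fx z) (fy z) \<bullet> cross3 (fx z) (fy z) = \<nu>2 z * \<nu>2 z"
    by (simp add: power2_norm_eq_inner)
  then show "n z \<bullet> n z = 1" "n z \<bullet> fx z = 0" "n z \<bullet> fy z = 0"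
    using metric(1)[OF that] by (simp_all add: n_def dot_cross_self)
qed

text \<open>The vector product with \<open>n\<close> rotates the tangent plane by a right angle,
  which later identifies the conormal.\<close>

lemma n_cross: "cross3 (n z) (fx z) = fy z" "cross3 (n z) (fy z) = - fx z" if "z \<in> U"
proof -
  have "cross3 (cross3 a b) a = (a \<bullet> a) *\<^sub>R b - (a \<bullet> b) *\<^sub>R a"
    "cross3 (cross3 a b) b = (a \<bullet> b) *\<^sub>R b - (b \<bullet> b) *\<^sub>R a" for a b :: "real^3"
    by (simp_all add: cross3_simps forall_3)
  then show "cross3 (n z) (fx z) = fy z" "cross3 (n z) (fy z) = - fx z"
    using metric[OF that] by (simp_all add: n_def cross_mult_left)
qed

lemma n_differentiable: "n differentiable (at z)" if "z \<in> U"
proof -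
  interpret c: bounded_bilinear cross3
    using bilinear_cross bilinear_conv_bounded_bilinear by blast
  note d = diff[OF that, THEN has_derivative_pd]
  have "(\<lambda>z. cross3 (fx z) (fy z)) differentiable (at z)"
    using c.FDERIV[OF d(2,3)] by (rule differentiableI)
  moreover have "(\<lambda>z. 1 / \<nu>2 z) differentiable (at z)"
    unfolding \<nu>2_def using has_derivative_inner[OF d(2) d(2)] metric(1,2)[OF that]
    by (intro differentiable_divide differentiable_const) (auto intro: differentiableI)
  ultimately show ?thesis
    unfolding n_def by (rule differentiable_scaleR[rotated])
qed

text \<open>Expanding \<open>N\<close> in the frame \<open>fx\<close>, \<open>fy\<close>,
  \<open>n\<close> shows that \<open>N z \<bullet> n z\<close> is 1 or -1. Being continuous, it is
  constant on a connected set.\<close>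

lemma normal_sign:
  assumes "connected S" "S \<subseteq> U"
  obtains \<sigma> where "\<sigma> * \<sigma> = 1" "\<And>z. z \<in> S \<Longrightarrow> N z = \<sigma> *\<^sub>R n z"
proof (cases "S = {}")
  case True
  then show ?thesis using that[of 1] by simp
next
  case False
  have sq: "(N z \<bullet> n z) * (N z \<bullet> n z) = 1" and eq: "N z = (N z \<bullet> n z) *\<^sub>R n z" if "z \<in> U" for z
  proof -
    have "\<nu>2 z * (N z \<bullet> N z) = \<nu>2 z * (N z \<bullet> n z) * (N z \<bullet> n z)"
      using orthogonal_frame_expansion[OF metric(2,3,1,4) n_unit, OF that that that that that that that,
          of "N z" "N z"] unit_normal[OF that] by simp
    then show sq: "(N z \<bullet> n z) * (N z \<bullet> n z) = 1"
      using unit_normal(1)[OF that] metric(1)[OF that] by simp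
    have "(N z - (N z \<bullet> n z) *\<^sub>R n z) \<bullet> (N z - (N z \<bullet> n z) *\<^sub>R n z) = 0"
      using sq unit_normal(1)[OF that] n_unit(1)[OF that]
      unfolding inner_diff_left inner_diff_right inner_scaleR_left inner_scaleR_right
        inner_commute[of "n z" "N z"] by simp
    then show "N z = (N z \<bullet> n z) *\<^sub>R n z"
      by (simp only: inner_eq_zero_iff right_minus_eq)
  qed
  have "continuous_on U n"
    using n_differentiable by (auto intro!: continuous_at_imp_continuous_on differentiable_imp_continuous_within)
  then have "continuous_on S (\<lambda>z. N z \<bullet> n z)"
    using continuous_on_N assms(2) by (intro continuous_on_inner) (auto intro: continuous_on_subset)
  moreover have "(\<lambda>z. N z \<bullet> n z) ` S \<subseteq> {1, -1}"
    using sq assms(2) by (auto simp: square_eq_1_iff)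
  then have "finite ((\<lambda>z. N z \<bullet> n z) ` S)"
    by (rule finite_subset) simp
  ultimately have "(\<lambda>z. N z \<bullet> n z) constant_on S"
    using \<open>connected S\<close> by (intro continuous_finite_range_constant)
  then obtain \<sigma> where \<sigma>: "\<And>z. z \<in> S \<Longrightarrow> N z \<bullet> n z = \<sigma>"
    unfolding constant_on_def by blast
  show ?thesis
  proof (rule that)
    obtain z where "z \<in> S" using False by blast
    then show "\<sigma> * \<sigma> = 1"
      using sq[of z] \<sigma>[of z] assms(2) by auto
    show "N z = \<sigma> *\<^sub>R n z" if "z \<in> S" for z
      using eq[of z] \<sigma>[OF that] assms(2) that by auto
  qed
qed

text \<open>The sign relating \<open>N\<close> to \<open>n\<close> is fixed on a small ball.\<close>

lemma N_differentiable: "N differentiable (at z)" if z: "z \<in> U"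
proof -
  obtain e where e: "e > 0" "ball z e \<subseteq> U"
    using open_U z by (meson openE)
  obtain \<sigma> where \<sigma>: "\<And>w. w \<in> ball z e \<Longrightarrow> N w = \<sigma> *\<^sub>R n w"
    using normal_sign[OF connected_ball e(2)] by blast
  have "((\<lambda>w. \<sigma> *\<^sub>R n w) has_derivative (\<lambda>w. \<sigma> *\<^sub>R (Re w *\<^sub>R pdx n z + Im w *\<^sub>R pdy n z))) (at z)"
    using n_differentiable[OF z] by (intro has_derivative_scaleR_right has_derivative_pd)
  then have "(N has_derivative (\<lambda>w. \<sigma> *\<^sub>R (Re w *\<^sub>R pdx n z + Im w *\<^sub>R pdy n z))) (at z)"
    by (rule has_derivative_transform_within_open[of _ _ _ _ "ball z e"]) (use \<sigma> e in auto)
  then show ?thesis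
    by (rule differentiableI)
qed

text \<open>First derivatives of the identities \<open>\<langle>f\<^sub>x,f\<^sub>x\<rangle> = \<langle>f\<^sub>y,f\<^sub>y\<rangle>\<close>, \<open>\<langle>f\<^sub>x,f\<^sub>y\<rangle> = 0\<close>, \<open>\<langle>N,f\<^sub>x\<rangle> = \<langle>N,f\<^sub>y\<rangle> = 0\<close>
  and \<open>\<langle>N,N\<rangle> = 1\<close>.\<close>
lemma differentiated_identities:
  assumes z: "z \<in> U"
  shows "pdx fx z \<bullet> fx z = pdy fx z \<bullet> fy z" "pdy fx z \<bullet> fx z = pdy fy z \<bullet> fy z"
    "pdx fx z \<bullet> fy z = - (pdy fx z \<bullet> fx z)" "pdy fy z \<bullet> fx z = - (pdy fx z \<bullet> fy z)"
    "pdx N z \<bullet> fx z = - L z" "pdy N z \<bullet> fx z = - M z"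
    "pdx N z \<bullet> fy z = - M z" "pdy N z \<bullet> fy z = - G z"
    "pdx N z \<bullet> N z = 0" "pdy N z \<bullet> N z = 0"
proof -
  note d = diff[OF z, THEN has_derivative_pd]
  note dN = N_differentiable[OF z, THEN has_derivative_pd]
  note zero = has_derivative_zero_on_open[OF open_U z]
  note sym = pdx_fy[OF z] inner_commute[of "fx z"] inner_commute[of "fy z"] inner_commute[of "N z"]
  \<comment> \<open>Each identity is differentiated in an arbitrary direction \<open>w\<close>; then
    \<open>w = 1\<close> and \<open>w = \<i>\<close> give the two partial derivatives.\<close>
  have xx: "(Re w *\<^sub>R pdx fx z + Im w *\<^sub>R pdy fx z) \<bullet> fx z = (Re w *\<^sub>R pdx fy z + Im w *\<^sub>R pdy fy z) \<bullet> fy z" for w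
    using zero[OF _ has_derivative_diff[OF has_derivative_inner[OF d(2) d(2)] has_derivative_inner[OF d(3) d(3)]], of 0 w]
      metric by (simp add: sym)
  have xy: "(Re w *\<^sub>R pdx fx z + Im w *\<^sub>R pdy fx z) \<bullet> fy z + (Re w *\<^sub>R pdx fy z + Im w *\<^sub>R pdy fy z) \<bullet> fx z = 0" for w
    using zero[OF _ has_derivative_inner[OF d(2) d(3)], of 0 w] metric by (simp add: sym)
  have Nx: "(Re w *\<^sub>R pdx N z + Im w *\<^sub>R pdy N z) \<bullet> fx z + (Re w *\<^sub>R pdx fx z + Im w *\<^sub>R pdy fx z) \<bullet> N z = 0" for w
    using zero[OF _ has_derivative_inner[OF dN d(2)], of 0 w] unit_normal by (simp add: sym)
  have Ny: "(Re w *\<^sub>R pdx N z + Im w *\<^sub>R pdy N z) \<bullet> fy z + (Re w *\<^sub>R pdx fy z + Im w *\<^sub>R pdy fy z) \<bullet> N z = 0" for w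
    using zero[OF _ has_derivative_inner[OF dN d(3)], of 0 w] unit_normal by (simp add: sym)
  have NN: "(Re w *\<^sub>R pdx N z + Im w *\<^sub>R pdy N z) \<bullet> N z = 0" for w
    using zero[OF _ has_derivative_inner[OF dN dN], of 1 w] unit_normal by (simp add: sym)
  show "pdx fx z \<bullet> fx z = pdy fx z \<bullet> fy z" "pdy fx z \<bullet> fx z = pdy fy z \<bullet> fy z"
    using xx[of 1] xx[of \<i>] by (simp_all add: pdx_fy[OF z])
  show "pdx fx z \<bullet> fy z = - (pdy fx z \<bullet> fx z)" "pdy fy z \<bullet> fx z = - (pdy fx z \<bullet> fy z)"
    using xy[of 1] xy[of \<i>] by (simp_all add: pdx_fy[OF z])
  show "pdx N z \<bullet> fx z = - L z" "pdy N z \<bullet> fx z = - M z"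
    "pdx N z \<bullet> fy z = - M z" "pdy N z \<bullet> fy z = - G z"
    using Nx[of 1] Nx[of \<i>] Ny[of 1] Ny[of \<i>] by (simp_all add: pdx_fy[OF z] L_def M_def G_def)
  show "pdx N z \<bullet> N z = 0" "pdy N z \<bullet> N z = 0"
    using NN[of 1] NN[of \<i>] by simp_all
qed

section \<open>Holomorphy of the Hopf function and its zeros\<close>

lemma continuous_on_hopf: "continuous_on U hopf"
  unfolding hopf_def L_def M_def G_def
  by (intro continuous_on_Complex continuous_intros continuous_on_diff2 continuous_on_N)

lemma sum_curvature: "L z + G z = 2 * mean_curv f N z * \<nu>2 z" if "z \<in> U"
  using metric(1)[OF that] by (simp add: mean_curv_def L_def G_def \<nu>2_def inner_add_left)

text \<open>Codazzi's equations for constant \<open>H\<close>, in a form without third derivatives of \<open>f\<close>.\<close>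
lemma weak_codazzi:
  assumes z: "z \<in> U" and H: "mean_curv f N z = H"
  shows "pdx N z \<bullet> pdy fx z - pdy N z \<bullet> pdx fx z = - 2 * H * (pdy fx z \<bullet> fx z)"
    "pdx N z \<bullet> pdy fy z - pdy N z \<bullet> pdy fx z = 2 * H * (pdx fx z \<bullet> fx z)"
proof -
  note frame = orthogonal_frame_expansion[OF metric(2,3,1,4) unit_normal(1-3), OF z z z z z z z]
  note ids = differentiated_identities[OF z]
  have LG: "L z + G z = 2 * H * \<nu>2 z"
    using sum_curvature[OF z] H by simp
  \<comment> \<open>The normal parts drop out, as the derivatives of \<open>N\<close> are
    tangential, and the terms with \<open>M\<close> cancel by \<open>ids(1)\<close>.\<close>
  have "\<nu>2 z * (pdx N z \<bullet> pdy fx z - pdy N z \<bullet> pdx fx z) = - (L z + G z) * (pdy fx z \<bullet> fx z)"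
    using frame[of "pdx N z" "pdy fx z"] frame[of "pdy N z" "pdx fx z"]
    unfolding ids(3,5-10) ids(1)[symmetric] by (simp add: algebra_simps)
  also have "\<dots> = \<nu>2 z * (- 2 * H * (pdy fx z \<bullet> fx z))"
    unfolding LG by simp
  finally show "pdx N z \<bullet> pdy fx z - pdy N z \<bullet> pdx fx z = - 2 * H * (pdy fx z \<bullet> fx z)"
    using metric(1)[OF z] by (simp only: mult_cancel_left) simp
  have "\<nu>2 z * (pdx N z \<bullet> pdy fy z - pdy N z \<bullet> pdy fx z) = (L z + G z) * (pdx fx z \<bullet> fx z)"
    using frame[of "pdx N z" "pdy fy z"] frame[of "pdy N z" "pdy fx z"]
    unfolding ids(4-10) ids(2)[symmetric] ids(1)[symmetric] by (simp add: algebra_simps)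
  also have "\<dots> = \<nu>2 z * (2 * H * (pdx fx z \<bullet> fx z))"
    unfolding LG by simp
  finally show "pdx N z \<bullet> pdy fy z - pdy N z \<bullet> pdy fx z = 2 * H * (pdx fx z \<bullet> fx z)"
    using metric(1)[OF z] by (simp only: mult_cancel_left) simp
qed

lemma hopf_holomorphic:
  assumes H: "\<And>z. z \<in> U \<Longrightarrow> mean_curv f N z = H"
  shows "hopf holomorphic_on U"
proof -
  \<comment> \<open>\<open>B\<close> pairs the coefficients \<open>(N, \<nu>2)\<close> with the
    differentials of \<open>fx\<close>, \<open>fy\<close> and \<open>cnj\<close>. The constant
    \<open>H\<close> is absorbed into \<open>B\<close>.\<close>
  define B where "B = (\<lambda>(a :: (real^3) \<times> real) (u :: ((real^3) \<times> (real^3)) \<times> complex).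
    complex_of_real (2 * (fst a \<bullet> fst (fst u))) - \<i> * complex_of_real (2 * (fst a \<bullet> snd (fst u)))
      - complex_of_real (2 * H * snd a) * snd u)"
  define a' where "a' = (\<lambda>z w. (Re w *\<^sub>R pdx N z + Im w *\<^sub>R pdy N z,
      2 * (fx z \<bullet> (Re w *\<^sub>R pdx fx z + Im w *\<^sub>R pdy fx z))))"
  define u' where "u' = (\<lambda>z w. ((Re w *\<^sub>R pdx fx z + Im w *\<^sub>R pdy fx z,
      Re w *\<^sub>R pdx fy z + Im w *\<^sub>R pdy fy z), cnj w))"
  have "bilinear B"
    unfolding bilinear_def B_def
    by (intro conjI allI linearI; simp add: inner_add_left inner_add_right complex_eq_iff; simp add: algebra_simps)
  then have B: "bounded_bilinear B"
    by (simp add: bilinear_conv_bounded_bilinear)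
  then interpret B: bounded_bilinear B .
  show ?thesis
  proof (rule holomorphic_on_closed_form[OF open_U continuous_on_hopf B,
        where a = "\<lambda>z. (N z, \<nu>2 z)" and a' = a' and u = "\<lambda>z. ((fx z, fy z), cnj z)" and u' = u'])
    fix z assume z: "z \<in> U"
    note d = diff[OF z, THEN has_derivative_pd]
    show "((\<lambda>z. (N z, \<nu>2 z)) has_derivative a' z) (at z)"
      unfolding a'_def \<nu>2_def
      using has_derivative_inner[OF d(2) d(2)]
      by (intro has_derivative_Pair has_derivative_pd N_differentiable z) (simp add: inner_commute[of _ "fx z"])
    show "((\<lambda>z. ((fx z, fy z), cnj z)) has_derivative u' z) (at z)"
      unfolding u'_def
      by (intro has_derivative_Pair d(2,3)) (auto intro!: derivative_eq_intros)
    fix w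
    \<comment> \<open>This turns \<open>2 * H * \<nu>2 z\<close> into \<open>L z + G z\<close>,
      after which the form is exactly \<open>hopf z * w\<close>.\<close>
    have LG: "L z + G z = 2 * H * \<nu>2 z"
      using sum_curvature[OF z] H[OF z] by simp
    have "N z \<bullet> pdx fx z = L z" "N z \<bullet> pdy fx z = M z" "N z \<bullet> pdy fy z = G z"
      by (simp_all add: L_def M_def G_def inner_commute)
    then show "hopf z * w = B (N z, \<nu>2 z) (u' z w)"
      unfolding hopf_def B_def u'_def complex_eq_iff
      by (simp add: inner_add_right pdx_fy[OF z] LG[symmetric]) (simp add: algebra_simps)
    fix v
    have a': "a' z w = Re w *\<^sub>R a' z 1 + Im w *\<^sub>R a' z \<i>" for w
      by (simp add: a'_def inner_add_right algebra_simps)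
    have u': "u' z w = Re w *\<^sub>R u' z 1 + Im w *\<^sub>R u' z \<i>" for w
      by (simp add: u'_def complex_eq_iff)
    \<comment> \<open>The antisymmetrisation in \<open>v\<close> and \<open>w\<close> is a real
      alternating form on the plane, so the single pair \<open>1\<close>, \<open>\<i>\<close>
      suffices; there it amounts to \<open>weak_codazzi\<close>.\<close>
    have "B (a' z 1) (u' z \<i>) = B (a' z \<i>) (u' z 1)"
      using weak_codazzi[OF z H[OF z]]
      by (simp add: B_def a'_def u'_def complex_eq_iff pdx_fy[OF z] inner_commute[of "fx z"])
    then show "B (a' z v) (u' z w) = B (a' z w) (u' z v)"
      unfolding a'[of v] a'[of w] u'[of v] u'[of w] B.add_left B.add_right B.scaleR_left B.scaleR_right
      by (simp add: algebra_simps)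
  next
    fix p and e :: real assume p: "p \<in> U" and "e > 0"
    \<comment> \<open>\<open>E\<close> bounds the oscillation of \<open>u'\<close> around
      \<open>p\<close>; the component \<open>cnj\<close> has constant derivative and contributes
      nothing.\<close>
    define E where "E = (\<lambda>z. norm (pdx fx z - pdx fx p) + norm (pdy fx z - pdy fx p)
      + (norm (pdx fy z - pdx fy p) + norm (pdy fy z - pdy fy p)))"
    have "continuous_on U E"
      unfolding E_def by (intro continuous_intros continuous_on_diff2)
    then have "isCont E p"
      using open_U p by (simp add: continuous_on_eq_continuous_at)
    moreover have "E p = 0"
      by (simp add: E_def)
    ultimately obtain d where d: "d > 0" "\<And>z. dist z p < d \<Longrightarrow> \<bar>E z\<bar> < e"
      using \<open>e > 0\<close> unfolding continuous_at_eps_delta dist_real_def by (metis diff_zero)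
    have lin: "norm ((Re w *\<^sub>R x + Im w *\<^sub>R y) - (Re w *\<^sub>R x' + Im w *\<^sub>R y'))
        \<le> (norm (x - x') + norm (y - y')) * norm w" for w and x y x' y' :: "real^3"
    proof -
      have "(Re w *\<^sub>R x + Im w *\<^sub>R y) - (Re w *\<^sub>R x' + Im w *\<^sub>R y') = Re w *\<^sub>R (x - x') + Im w *\<^sub>R (y - y')"
        by (simp add: algebra_simps)
      also have "norm \<dots> \<le> \<bar>Re w\<bar> * norm (x - x') + \<bar>Im w\<bar> * norm (y - y')"
        using norm_triangle_ineq[of "Re w *\<^sub>R (x - x')" "Im w *\<^sub>R (y - y')"] by simp
      also have "\<dots> \<le> norm w * norm (x - x') + norm w * norm (y - y')"
        by (intro add_mono mult_right_mono abs_Re_le_cmod abs_Im_le_cmod) auto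
      finally show ?thesis
        by (simp add: algebra_simps)
    qed
    have "norm (u' z w - u' p w) \<le> e * norm w" if "z \<in> ball p d" for z w
    proof -
      have "norm (u' z w - u' p w) \<le> E z * norm w"
        unfolding u'_def diff_Pair E_def distrib_right
        by (rule order_trans[OF norm_Pair_le], simp only: diff_self norm_zero add_0_right)
           (intro order_trans[OF norm_Pair_le] add_mono lin[unfolded distrib_right])
      also have "\<dots> \<le> e * norm w"
        using d(2)[of z] that by (intro mult_right_mono) (auto simp: dist_commute)
      finally show ?thesis .
    qed
    with d(1) show "\<exists>d>0. \<forall>z\<in>ball p d. \<forall>w. norm (u' z w - u' p w) \<le> e * norm w"
      by blast
  qed
qed

text \<open>In conformal coordinates the first form is \<open>\<nu>2\<close> times the identity, so
  proportionality means \<open>L z = G z\<close> and \<open>M z = 0\<close>.\<close>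

lemma umbilic_iff_hopf_zero: "umbilic_at f N z \<longleftrightarrow> hopf z = 0" if "z \<in> U"
proof
  assume "umbilic_at f N z"
  then show "hopf z = 0"
    using metric[OF that] by (auto simp: umbilic_at_def hopf_def L_def M_def G_def complex_eq_iff)
next
  assume "hopf z = 0"
  then have "L z = G z" "M z = 0"
    by (auto simp: hopf_def complex_eq_iff)
  then show "umbilic_at f N z"
    unfolding umbilic_at_def using metric[OF that]
    by (intro exI[of _ "L z / \<nu>2 z"]) (auto simp: L_def M_def G_def)
qed

end

section \<open>The boundary curve\<close>

locale conformal_disc = conformal_immersion +
  assumes disc: "cball 0 1 \<subseteq> U"
begin

text \<open>\<open>T\<close> and \<open>T'\<close> are \<open>\<gamma>'\<close> and \<open>\<gamma>''\<close>; \<open>J\<close> is \<open>T\<close> rotated by a right angle in the tangent plane.\<close>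
definition "T t = (- sin t) *\<^sub>R fx (cis t) + cos t *\<^sub>R fy (cis t)"
definition "J t = (- sin t) *\<^sub>R fy (cis t) - cos t *\<^sub>R fx (cis t)"
definition "T' t = (- cos t) *\<^sub>R fx (cis t) - sin t *\<^sub>R fy (cis t)
    + (- sin t) *\<^sub>R ((- sin t) *\<^sub>R pdx fx (cis t) + cos t *\<^sub>R pdy fx (cis t))
    + cos t *\<^sub>R ((- sin t) *\<^sub>R pdx fy (cis t) + cos t *\<^sub>R pdy fy (cis t))"
definition "J' t = (- cos t) *\<^sub>R fy (cis t) + sin t *\<^sub>R fx (cis t)
    + (- sin t) *\<^sub>R ((- sin t) *\<^sub>R pdx fy (cis t) + cos t *\<^sub>R pdy fy (cis t))
    - cos t *\<^sub>R ((- sin t) *\<^sub>R pdx fx (cis t) + cos t *\<^sub>R pdy fx (cis t))"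
definition "speed t = sqrt (\<nu>2 (cis t))"

lemma cis_in_U: "cis t \<in> U"
  using disc by auto

lemma speed: "speed t > 0" "speed t * speed t = \<nu>2 (cis t)"
  using metric(1)[OF cis_in_U[of t]] by (simp_all add: speed_def)

lemma vector_derivative_bcurve: "vector_derivative (bcurve f) (at t) = T t"
  unfolding bcurve_def T_def
  by (intro vector_derivative_at has_vector_derivative_along_circle diff cis_in_U)

lemma norm_T: "norm (T t) = speed t"
proof -
  have "T t \<bullet> T t = sin t * sin t * \<nu>2 (cis t) + cos t * cos t * \<nu>2 (cis t)"
    using metric[OF cis_in_U[of t]]
    by (simp add: T_def inner_add_left inner_add_right inner_diff_left inner_diff_right)
  also have "\<dots> = \<nu>2 (cis t)"
    unfolding distrib_right[symmetric] power2_eq_square[symmetric] by simp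
  finally show ?thesis
    by (simp add: norm_eq_sqrt_inner speed_def)
qed

lemma btangent_eq: "btangent f = (\<lambda>t. (1 / speed t) *\<^sub>R T t)"
  by (simp add: btangent_def vector_derivative_bcurve norm_T fun_eq_iff)

lemma T_derivative: "(T has_vector_derivative T' t) (at t)"
  unfolding T_def T'_def
  by (rule derivative_eq_intros has_vector_derivative_along_circle diff cis_in_U refl | simp)+

lemma J_derivative: "(J has_vector_derivative J' t) (at t)"
  unfolding J_def J'_def
  by (rule derivative_eq_intros has_vector_derivative_along_circle diff cis_in_U refl | simp)+

lemma inverse_speed_derivative: "\<exists>r. ((\<lambda>t. 1 / speed t) has_vector_derivative r) (at t)"
proof -
  note d = has_vector_derivative_along_circle[OF diff(2)[OF cis_in_U], unfolded has_vector_derivative_def]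
  have "(\<lambda>t. \<nu>2 (cis t)) differentiable (at t)"
    unfolding \<nu>2_def using has_derivative_inner[OF d d] by (rule differentiableI)
  then obtain D where "((\<lambda>t. \<nu>2 (cis t)) has_real_derivative D) (at t)"
    by (auto simp: real_differentiable_def)
  from DERIV_inverse_fun[OF DERIV_chain2[OF DERIV_real_sqrt this]] speed(1)[of t] metric(1)[OF cis_in_U[of t]]
  show ?thesis
    by (auto simp: speed_def inverse_eq_divide has_real_derivative_iff_has_vector_derivative)
qed

text \<open>In the product rule the derivative of \<open>1 / speed\<close> multiplies the tangential
  vector \<open>V t\<close>, so its value is irrelevant to the normal component.\<close>

lemma normal_component_of_derivative:
  assumes "(V has_vector_derivative V') (at t)" "V t \<bullet> N (cis t) = 0"
  shows "vector_derivative (\<lambda>t. (1 / speed t) *\<^sub>R V t) (at t) \<bullet> N (cis t) = (V' \<bullet> N (cis t)) / speed t"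
proof -
  obtain r where r: "((\<lambda>t. 1 / speed t) has_vector_derivative r) (at t)"
    using inverse_speed_derivative by blast
  have "((\<lambda>t. (1 / speed t) *\<^sub>R V t) has_vector_derivative (1 / speed t) *\<^sub>R V' + r *\<^sub>R V t) (at t)"
    using has_vector_derivative_scaleR[OF r[folded has_real_derivative_iff_has_vector_derivative] assms(1)] .
  from vector_derivative_at[OF this] show ?thesis
    using assms(2) by (simp add: inner_add_left)
qed

text \<open>The normal curvature is the second form on \<open>T\<close> divided by
  \<open>\<nu>2\<close>. Double angle formulas split it into its trace part, the mean curvature, and
  a trace-free part given by \<open>hopf\<close>.\<close>

lemma normal_curv_eq:
  "normal_curv f N t = mean_curv f N (cis t) - Re ((cis t)\<^sup>2 * hopf (cis t)) / (2 * \<nu>2 (cis t))"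
proof -
  let ?z = "cis t"
  note un = unit_normal[OF cis_in_U[of t]]
  have T0: "T t \<bullet> N ?z = 0"
    using un by (simp add: T_def inner_add_left inner_diff_left)
  have "normal_curv f N t = T' t \<bullet> N ?z / speed t / speed t"
    using normal_component_of_derivative[OF T_derivative T0]
    by (simp add: normal_curv_def vector_derivative_bcurve norm_T btangent_eq bnormal_def)
  also have "\<dots> = T' t \<bullet> N ?z / \<nu>2 ?z"
    by (simp flip: speed(2))
  also have "T' t \<bullet> N ?z = (sin t)\<^sup>2 * L ?z - 2 * sin t * cos t * M ?z + (cos t)\<^sup>2 * G ?z"
    unfolding T'_def pdx_fy[OF cis_in_U] inner_add_left inner_diff_left inner_scaleR_left un
      L_def[symmetric] M_def[symmetric] G_def[symmetric]
    by (simp add: power2_eq_square algebra_simps)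
  also have "\<dots> = (L ?z + G ?z) / 2 - Re (?z\<^sup>2 * hopf ?z) / 2"
  proof -
    have "Re (?z\<^sup>2 * hopf ?z) = ((cos t)\<^sup>2 - (sin t)\<^sup>2) * (L ?z - G ?z) + 4 * sin t * cos t * M ?z"
      by (simp add: hopf_def power2_eq_square)
    then show ?thesis
      by (simp only: cos_squared_eq) (simp add: field_simps)
  qed
  also have "(\<dots>) / \<nu>2 ?z = mean_curv f N ?z - Re (?z\<^sup>2 * hopf ?z) / (2 * \<nu>2 ?z)"
    using sum_curvature[OF cis_in_U[of t]] metric(1)[OF cis_in_U[of t]] by (simp add: field_simps)
  finally show ?thesis .
qed

text \<open>The conormal is \<open>\<sigma>\<close> times the normalised \<open>J\<close>. As the
  closed disc is connected, one sign serves for all \<open>t\<close>.\<close>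

lemma geod_torsion_eq:
  obtains \<sigma> where "\<sigma> * \<sigma> = (1 :: real)"
    "\<And>t. geod_torsion f N t = \<sigma> * Im ((cis t)\<^sup>2 * hopf (cis t)) / (2 * \<nu>2 (cis t))"
proof -
  obtain \<sigma> where \<sigma>: "\<sigma> * \<sigma> = 1" "\<And>z. z \<in> cball 0 1 \<Longrightarrow> N z = \<sigma> *\<^sub>R n z"
    using normal_sign[OF connected_cball disc] by blast
  have J: "bconormal f N t = (1 / speed t) *\<^sub>R (\<sigma> *\<^sub>R J t)" for t
    using n_cross[OF cis_in_U[of t]] \<sigma>(2)[of "cis t"]
    by (simp add: bconormal_def bnormal_def btangent_eq T_def J_def cross_add_right cross_mult_left
        cross_mult_right Cross3.right_diff_distrib algebra_simps)
  have "geod_torsion f N t = \<sigma> * Im ((cis t)\<^sup>2 * hopf (cis t)) / (2 * \<nu>2 (cis t))" for t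
  proof -
    let ?z = "cis t"
    note un = unit_normal[OF cis_in_U[of t]]
    have J0: "(\<sigma> *\<^sub>R J t) \<bullet> N ?z = 0"
      using un by (simp add: J_def inner_add_left inner_diff_left)
    have "((\<lambda>t. \<sigma> *\<^sub>R J t) has_vector_derivative \<sigma> *\<^sub>R J' t) (at t)"
      using J_derivative by (auto intro!: derivative_eq_intros)
    from normal_component_of_derivative[OF this J0]
    have "geod_torsion f N t = \<sigma> * (J' t \<bullet> N ?z) / speed t / speed t"
      by (simp add: geod_torsion_def vector_derivative_bcurve norm_T J[abs_def] bnormal_def)
    also have "\<dots> = \<sigma> * (J' t \<bullet> N ?z) / \<nu>2 ?z"
      by (simp flip: speed(2))
    also have "J' t \<bullet> N ?z = Im (?z\<^sup>2 * hopf ?z) / 2"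
      unfolding J'_def pdx_fy[OF cis_in_U] inner_add_left inner_diff_left inner_scaleR_left un
        L_def[symmetric] M_def[symmetric] G_def[symmetric]
      by (simp add: hopf_def power2_eq_square algebra_simps)
    finally show ?thesis
      by simp
  qed
  with \<sigma>(1) show ?thesis
    by (rule that)
qed

lemma continuous_on_normal_curv:
  assumes "\<And>z. z \<in> U \<Longrightarrow> mean_curv f N z = H"
  shows "continuous_on A (normal_curv f N)"
proof -
  have cis: "continuous_on A cis" "cis ` A \<subseteq> U"
    using cis_in_U by (auto intro!: continuous_intros)
  have "normal_curv f N = (\<lambda>t. H - Re ((cis t)\<^sup>2 * hopf (cis t)) / (2 * \<nu>2 (cis t)))"
    using normal_curv_eq assms[OF cis_in_U] by auto
  moreover have "continuous_on A (\<lambda>t. hopf (cis t))"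
    using continuous_on_hopf cis by (rule continuous_on_compose2)
  moreover have "continuous_on A (\<lambda>t. \<nu>2 (cis t))"
    unfolding \<nu>2_def by (intro continuous_on_inner continuous_on_compose2[OF continuous_on_diff(1) cis])
  moreover have "2 * \<nu>2 (cis t) \<noteq> 0" for t
    using metric(1)[OF cis_in_U[of t]] by simp
  ultimately show ?thesis
    by (simp only:) (intro continuous_intros cis; simp)
qed

end

theorem theorem1p1:
  fixes H :: real and U :: "complex set" and f N :: "complex \<Rightarrow> real^3"
  assumes "open U" and "cball 0 1 \<subseteq> U"
    and "C2_on U f" and "conformal_on U f" and "unit_normal_field U f N"
    and "\<forall>z\<in>U. mean_curv f N z = H"
    and "real_analytic_on UNIV (bcurve f)"
    and "\<forall>t. vector_derivative (bcurve f) (at t) \<noteq> 0"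
  shows "(totally_umbilic_on (cball 0 1) f N \<longleftrightarrow>
            ((\<exists>c. \<forall>t\<in>{0..2*pi}. normal_curv f N t = c) \<or>
             (\<exists>c. \<forall>t\<in>{0..2*pi}. geod_torsion f N t = c)))
       \<and> (totally_umbilic_on (cball 0 1) f N \<longrightarrow>
            (\<forall>t\<in>{0..2*pi}. normal_curv f N t = H \<and> geod_torsion f N t = 0))
       \<and> (\<not> totally_umbilic_on (cball 0 1) f N \<longrightarrow>
            (INF t\<in>{0..2*pi}. normal_curv f N t) < H \<and> H < (SUP t\<in>{0..2*pi}. normal_curv f N t))"
proof -
  interpret conformal_disc U f N
    using assms(1-5) by unfold_locales
  have hol: "hopf holomorphic_on U"
    using assms(6) by (intro hopf_holomorphic) simp
  have TU: "totally_umbilic_on (cball 0 1) f N \<longleftrightarrow> (\<forall>z\<in>cball 0 1. hopf z = 0)"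
    unfolding totally_umbilic_on_def using umbilic_iff_hopf_zero disc by blast
  define W where "W t = (cis t)\<^sup>2 * hopf (cis t)" for t
  have pos: "\<nu>2 (cis t) > 0" for t
    by (rule metric(1)[OF cis_in_U])
  have kn: "normal_curv f N t = H - Re (W t) / (2 * \<nu>2 (cis t))" for t
    using normal_curv_eq[of t] assms(6) cis_in_U[of t] by (simp add: W_def)
  obtain \<sigma> where \<sigma>: "\<sigma> * \<sigma> = 1" and
    tg: "\<And>t. geod_torsion f N t = \<sigma> * Im (W t) / (2 * \<nu>2 (cis t))"
    using geod_torsion_eq unfolding W_def by blast
  \<comment> \<open>All claims reduce to this: \<open>k = 1\<close> and \<open>k = -1\<close> test
    the sign of \<open>Re (W t)\<close>, \<open>k = - \<i>\<close> and \<open>k = \<i>\<close> that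
    of \<open>Im (W t)\<close>.\<close>
  have sign: "totally_umbilic_on (cball 0 1) f N"
    if "k \<noteq> 0" and nonneg: "\<And>t. t \<in> {0..2*pi} \<Longrightarrow> 0 \<le> Re (k * W t)" for k
  proof -
    have "0 \<le> Re (k * z\<^sup>2 * hopf z)" if "z \<in> sphere 0 1" for z
    proof -
      have "z = cis (Arg2pi z)"
        using that complex_norm_eq_1_exp[of z] by (simp add: cis_conv_exp)
      moreover have "Arg2pi z \<in> {0..2*pi}"
        using Arg2pi_ge_0[of z] Arg2pi_lt_2pi[of z] by simp
      ultimately show ?thesis
        using nonneg[of "Arg2pi z"] by (simp add: W_def mult.assoc)
    qed
    then show ?thesis
      unfolding TU using holomorphic_zero_from_boundary_sign[OF hol disc \<open>k \<noteq> 0\<close>] by blast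
  qed
  have le: "totally_umbilic_on (cball 0 1) f N" if "\<And>t. t \<in> {0..2*pi} \<Longrightarrow> normal_curv f N t \<le> H"
  proof (rule sign[of 1])
    fix t assume "t \<in> {0..2*pi}"
    from that[OF this] show "0 \<le> Re (1 * W t)"
      using pos[of t] by (simp add: kn zero_le_divide_iff)
  qed simp
  have ge: "totally_umbilic_on (cball 0 1) f N" if "\<And>t. t \<in> {0..2*pi} \<Longrightarrow> H \<le> normal_curv f N t"
  proof (rule sign[of "-1"])
    fix t assume "t \<in> {0..2*pi}"
    from that[OF this] show "0 \<le> Re (- 1 * W t)"
      using pos[of t] by (simp add: kn divide_le_0_iff)
  qed simp
  have umb: "normal_curv f N t = H \<and> geod_torsion f N t = 0"
    if "totally_umbilic_on (cball 0 1) f N" for t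
    using that by (simp add: TU kn tg W_def)
  \<comment> \<open>A constant is comparable with \<open>H\<close>, so \<open>le\<close> or
    \<open>ge\<close> applies.\<close>
  have kn_const: "totally_umbilic_on (cball 0 1) f N" if c: "\<forall>t\<in>{0..2*pi}. normal_curv f N t = c" for c
    using c le ge by (cases "c \<le> H") auto
  have tg_const: "totally_umbilic_on (cball 0 1) f N" if c: "\<forall>t\<in>{0..2*pi}. geod_torsion f N t = c" for c
  proof -
    \<comment> \<open>Since \<open>\<nu>2\<close> is positive, constant torsion gives
      \<open>Im (W t)\<close> the fixed sign of \<open>\<sigma> * c\<close>.\<close>
    have Im: "Im (W t) = \<sigma> * c * (2 * \<nu>2 (cis t))" if "t \<in> {0..2*pi}" for t
    proof -
      have "\<sigma> * Im (W t) = c * (2 * \<nu>2 (cis t))"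
        using bspec[OF c that, unfolded tg] pos[of t] by (simp add: field_simps)
      then have "\<sigma> * \<sigma> * Im (W t) = \<sigma> * c * (2 * \<nu>2 (cis t))"
        by simp
      then show ?thesis
        by (simp add: \<sigma>)
    qed
    show ?thesis
    proof (cases "\<sigma> * c \<ge> 0")
      case True
      have "0 \<le> Re (- \<i> * W t)" if "t \<in> {0..2*pi}" for t
        using Im[OF that] True pos[of t] by simp
      then show ?thesis
        by (intro sign[of "- \<i>"]) simp_all
    next
      case False
      have "0 \<le> Re (\<i> * W t)" if "t \<in> {0..2*pi}" for t
        using Im[OF that] False pos[of t] by (simp add: mult_nonpos_nonneg)
      then show ?thesis
        by (intro sign[of "\<i>"]) simp_all
    qed
  qed
  have strict: "(INF t\<in>{0..2*pi}. normal_curv f N t) < H \<and> H < (SUP t\<in>{0..2*pi}. normal_curv f N t)"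
    if not: "\<not> totally_umbilic_on (cball 0 1) f N"
  proof -
    \<comment> \<open>Compactness bounds the values, so that \<open>INF\<close> and
      \<open>SUP\<close> are genuine bounds to compare with \<open>t1\<close> and
      \<open>t2\<close>.\<close>
    have "compact (normal_curv f N ` {0..2*pi})"
      using assms(6) by (intro compact_continuous_image continuous_on_normal_curv[of H]) auto
    then have bdd: "bdd_below (normal_curv f N ` {0..2*pi})" "bdd_above (normal_curv f N ` {0..2*pi})"
      by (simp_all add: compact_imp_bounded bounded_imp_bdd_below bounded_imp_bdd_above)
    obtain t1 where t1: "t1 \<in> {0..2*pi}" "normal_curv f N t1 < H"
      using ge not by (meson not_le)
    obtain t2 where t2: "t2 \<in> {0..2*pi}" "H < normal_curv f N t2"
      using le not by (meson not_le)
    show ?thesis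
      using cINF_lower[OF bdd(1) t1(1)] cSUP_upper[OF t2(1) bdd(2)] t1(2) t2(2) by linarith
  qed
  show ?thesis
  proof (cases "totally_umbilic_on (cball 0 1) f N")
    case True
    with umb have eq: "\<forall>t\<in>{0..2*pi}. normal_curv f N t = H \<and> geod_torsion f N t = 0"
      by blast
    then have "\<exists>c. \<forall>t\<in>{0..2*pi}. normal_curv f N t = c"
      by blast
    with True eq show ?thesis
      by simp
  next
    case False
    then have "\<not> (\<exists>c. \<forall>t\<in>{0..2*pi}. normal_curv f N t = c)" "\<not> (\<exists>c. \<forall>t\<in>{0..2*pi}. geod_torsion f N t = c)"
      using kn_const tg_const by blast+
    with False strict[OF False] show ?thesis
      by (simp only: simp_thms)
  qed
qed

end
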